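(* Let $\mathbb{F}$ be a finite field and let $n,k,r\ge1$ be integers such that $s:=n \bmod (r+1)\notin\{0,1\}$, $r\mid (k+1)$ and $k\le\frac{rn}{r+1}$. Let $A\subseteq\mathbb{F}$ with $|A|=n$, let $m=\lceil\frac{n}{r+1}\rceil$, and let $\mathcal{A}=\{A_1,\dots,A_m\}$ be a partition of $A$ such that $|A_i|=r+1$ for $1\le i\le m-1$ and $|A_m|=s$. Let $g\in\mathbb{F}[x]$ be a polynomial of degree $r+1$ such that its powers $1,g,\dots,g^{m-1}$ span $\mathbb{F}_{\mathcal{A}}[x]$ and such that $g$ vanishes on $A_m$. Let $h_{A_m}(x)=\prod_{\alpha\in A_m}(x-\alpha)$. Write a vector $a\in\mathbb{F}^k$ as $a=(a_0,\dots,a_{r-1})$, where $a_i=(a_{i,0},\dots,a_{i,\frac{k+1}{r}-1})$ for $i\ne s-1$ and $a_{s-1}=(a_{s-1,1},\dots,a_{s-1,\frac{k+1}{r}-1})$, and define $$f_a(x)=\sum_{i=0}^{s-2}\sum_{j=0}^{\frac{k+1}{r}-1}a_{i,j}g(x)^jx^i+\sum_{j=1}^{\frac{k+1}{r}-1}a_{s-1,j}g(x)^jx^{s-1}+\sum_{i=s}^{r-1}\sum_{j=0}^{\frac{k+1}{r}-1}a_{i,j}g(x)^jx^{i-s}h_{A_m}(x).$$ Then the code $\{(f_a(\alpha))_{\alpha\in A}:a\in\mathbb{F}^k\}$ is an $(n,k,r)$ LRC code with minimum distance satisfying $$d\ge n-k-\Big\lceil\frac{k}{r}\Big\rceil+1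 .$$
   Context: $\mathbb{F}_{\mathcal{A}}[x]$ denotes the set of polynomials $f\in\mathbb{F}[x]$ with $\deg f<|A|$ that are constant on each block of the partition $\mathcal{A}$. A code $\mathcal{C}\subseteq\mathbb{F}^n$ has locality $r$ if for every coordinate $i$ there is a set $I_i$ of at most $r$ coordinates, not containing $i$, such that for codewords $x\in\mathcal{C}$ the symbol $x_i$ is a function of $(x_l)_{l\in I_i}$. An $(n,k,r)$ LRC code over $\mathbb{F}$ is a code of length $n$, cardinality $|\mathbb{F}|^k$ and locality $r$. *)

theory Defs
  imports Complex_Main "HOL-Library.FuncSet" "HOL-Library.Cardinality" "HOL-Library.Disjoint_Sets"
    "HOL-Computational_Algebra.Polynomial"
begin

(* A code of length n over 'a is a set of vectors C \<subseteq> 'a^I whose coordinates are indexed by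
   a finite set I with card I = n; vectors are the extensional functions I \<rightarrow>\<^sub>E UNIV. *)

definition hamming_dist :: "'i set \<Rightarrow> ('i \<Rightarrow> 'a) \<Rightarrow> ('i \<Rightarrow> 'a) \<Rightarrow> nat" where
  "hamming_dist I x y = card {i \<in> I. x i \<noteq> y i}"

(* Meaningful only for codes with at least two words. *)
definition min_dist :: "'i set \<Rightarrow> ('i \<Rightarrow> 'a) set \<Rightarrow> nat" where
  "min_dist I C = Min {hamming_dist I x y | x y. x \<in> C \<and> y \<in> C \<and> x \<noteq> y}"

definition has_locality :: "'i set \<Rightarrow> ('i \<Rightarrow> 'a) set \<Rightarrow> nat \<Rightarrow> bool" where
  "has_locality I C r \<longleftrightarrow>
     (\<forall>i\<in>I. \<exists>J. J \<subseteq> I \<and> i \<notin> J \<and> card J \<le> r \<and>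
        (\<exists>\<phi>. \<forall>x\<in>C. x i = \<phi> (restrict x J)))"

definition is_LRC_code :: "'i set \<Rightarrow> ('i \<Rightarrow> 'a::finite) set \<Rightarrow> nat \<Rightarrow> nat \<Rightarrow> nat \<Rightarrow> bool" where
  "is_LRC_code I C n k r \<longleftrightarrow>
     finite I \<and> card I = n \<and> C \<subseteq> (I \<rightarrow>\<^sub>E UNIV) \<and>
     card C = CARD('a) ^ k \<and> has_locality I C r"

definition block_const_polys :: "'a::field set \<Rightarrow> 'a set set \<Rightarrow> 'a poly set" where
  "block_const_polys A \<A> =
     {f. degree f < card A \<and> (\<forall>B\<in>\<A>. \<forall>x\<in>B. \<forall>y\<in>B. poly f x = poly f y)}"

definition annihilator_poly :: "'a::field set \<Rightarrow> 'a poly" where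
  "annihilator_poly B = (\<Prod>\<alpha>\<in>B. [:- \<alpha>, 1:])"

(* Entry a_{i,j} of a vector a = (a_0, ..., a_{r-1}) with coordinates numbered from 0, where
   the block a_i lists j = 0, ..., t-1, except that the block a_{s-1} lists j = 1, ..., t-1;
   every block from a_{s-1} on is therefore shifted by one position. *)
definition msg_entry :: "nat \<Rightarrow> nat \<Rightarrow> (nat \<Rightarrow> 'a) \<Rightarrow> nat \<Rightarrow> nat \<Rightarrow> 'a" where
  "msg_entry s t a i j = a (if i < s - 1 then i * t + j else i * t + j - 1)"

(* Here t stands for (k + 1) / r and h for the annihilator of the short block. *)
definition enc_poly ::
  "nat \<Rightarrow> nat \<Rightarrow> nat \<Rightarrow> 'a::field poly \<Rightarrow> 'a poly \<Rightarrow> (nat \<Rightarrow> 'a) \<Rightarrow> 'a poly" where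
  "enc_poly r s t g h a =
     (\<Sum>i = 0..<s - 1. \<Sum>j = 0..<t. smult (msg_entry s t a i j) (g ^ j * monom 1 i)) +
     (\<Sum>j = 1..<t. smult (msg_entry s t a (s - 1) j) (g ^ j * monom 1 (s - 1))) +
     (\<Sum>i = s..<r. \<Sum>j = 0..<t. smult (msg_entry s t a i j) (g ^ j * monom 1 (i - s) * h))"

definition eval_word :: "'a::field set \<Rightarrow> 'a poly \<Rightarrow> 'a \<Rightarrow> 'a" where
  "eval_word A f = (\<lambda>\<alpha>\<in>A. poly f \<alpha>)"

definition lrc_code ::
  "'a::field set \<Rightarrow> nat \<Rightarrow> nat \<Rightarrow> nat \<Rightarrow> 'a poly \<Rightarrow> 'a poly \<Rightarrow> ('a \<Rightarrow> 'a) set" where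
  "lrc_code A k r s g h =
     {eval_word A (enc_poly r s ((k + 1) div r) g h a) | a. a \<in> {..<k} \<rightarrow>\<^sub>E UNIV}"

end

theory Submission
  imports Defs
begin

text \<open>The encoding polynomial is a combination of the products of \<open>g ^ j\<close> with a monic polynomial of
  degree \<open>i\<close> (\<open>i < r\<close>, \<open>j < t\<close>), with the pair \<open>(s - 1, 0)\<close> left out. These products have the
  pairwise distinct degrees \<open>j * (r + 1) + i \<le> (r + 1) * t - 2 < n\<close>, which gives both the
  dimension and the distance. On a long block \<open>g\<close> is constant, so the encoding polynomial restricts to
  a polynomial of degree less than \<open>r\<close>; on the short block both \<open>g\<close> and its annihilator vanish, and
  thanks to the missing pair a polynomial of degree less than \<open>s - 1\<close> remains. In both cases the
  value at a point is determined by the values at the other points of its block.\<close>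

section \<open>Degrees, independence and agreement of polynomials\<close>

text \<open>Among the terms with nonzero coefficient, the one of largest degree is alone in reaching
  that degree, so its leading term cannot be cancelled.\<close>

lemma distinct_degrees_independent:
  fixes q :: "'i \<Rightarrow> 'a::field poly"
  assumes "finite K" and inj: "inj_on (\<lambda>i. degree (q i)) K" and nz: "\<And>i. i \<in> K \<Longrightarrow> q i \<noteq> 0"
    and sum: "(\<Sum>i\<in>K. smult (c i) (q i)) = 0" and "i \<in> K"
  shows "c i = 0"
proof (rule ccontr)
  assume "c i \<noteq> 0"
  let ?S = "{i \<in> K. c i \<noteq> 0}"
  have "finite ?S" "?S \<noteq> {}" using assms \<open>c i \<noteq> 0\<close> by auto
  then have "Max ((\<lambda>i. degree (q i)) ` ?S) \<in> (\<lambda>i. degree (q i)) ` ?S" by (intro Max_in) auto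
  then obtain l where l: "l \<in> ?S" and "Max ((\<lambda>i. degree (q i)) ` ?S) = degree (q l)" by blast
  then have max: "degree (q j) \<le> degree (q l)" if "j \<in> ?S" for j
    using Max_ge[of "(\<lambda>i. degree (q i)) ` ?S" "degree (q j)"] that \<open>finite ?S\<close> by auto
  have "c j * coeff (q j) (degree (q l)) = 0" if "j \<in> K - {l}" for j
  proof (cases "c j = 0")
    case False
    then have "degree (q j) < degree (q l)"
      using that l max[of j] inj by (auto simp: inj_on_def order.order_iff_strict)
    then show ?thesis by (simp add: coeff_eq_0)
  qed simp
  then have "(\<Sum>j\<in>K. c j * coeff (q j) (degree (q l))) = c l * lead_coeff (q l)"
    using l \<open>finite K\<close> by (simp add: sum.remove[of K l] sum.neutral)
  also have "(\<Sum>j\<in>K. c j * coeff (q j) (degree (q l))) = 0"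
    using arg_cong[OF sum, of "\<lambda>p. coeff p (degree (q l))"] by (simp add: coeff_sum)
  finally show False using l nz by auto
qed

lemma card_agree_le_degree:
  fixes p q :: "'a::field poly"
  assumes "p \<noteq> q"
  shows "card {x \<in> A. poly p x = poly q x} \<le> degree (p - q)"
proof -
  have "card {x \<in> A. poly p x = poly q x} \<le> card {x. poly (p - q) x = 0}"
    using assms by (intro card_mono poly_roots_finite) auto
  also have "\<dots> \<le> degree (p - q)" using assms by (intro card_poly_roots_bound) auto
  finally show ?thesis .
qed

lemma poly_eq_if_agree:
  fixes p q :: "'a::field poly"
  assumes "degree p < card J" and "degree q < card J" and "\<And>x. x \<in> J \<Longrightarrow> poly p x = poly q x"
  shows "p = q"
proof (rule ccontr)
  assume "p \<noteq> q"
  have "{x \<in> J. poly p x = poly q x} = J" using assms(3) by auto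
  with card_agree_le_degree[OF \<open>p \<noteq> q\<close>, of J] degree_diff_le_max[of p q] assms(1,2)
  show False by simp
qed

section \<open>Locality and distance of evaluation codes\<close>

text \<open>Codewords that agree on \<open>J\<close> share the symbol at \<open>i\<close>, so the
  recovery map may pick any codeword with the given values on \<open>J\<close> and read its symbol
  at \<open>i\<close>.\<close>

lemma has_localityI:
  assumes "\<And>i. i \<in> I \<Longrightarrow> \<exists>J. J \<subseteq> I \<and> i \<notin> J \<and> card J \<le> r \<and>
    (\<forall>x\<in>C. \<forall>y\<in>C. (\<forall>l\<in>J. x l = y l) \<longrightarrow> x i = y i)"
  shows "has_locality I C r"
  unfolding has_locality_def
proof
  fix i assume "i \<in> I"
  then obtain J where J: "J \<subseteq> I" "i \<notin> J" "card J \<le> r"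
    and det: "\<And>x y. x \<in> C \<Longrightarrow> y \<in> C \<Longrightarrow> \<forall>l\<in>J. x l = y l \<Longrightarrow> x i = y i"
    using assms[OF \<open>i \<in> I\<close>] by blast
  have "x i = (SOME y. y \<in> C \<and> restrict y J = restrict x J) i" if "x \<in> C" for x
  proof -
    let ?y = "SOME y. y \<in> C \<and> restrict y J = restrict x J"
    have "?y \<in> C \<and> restrict ?y J = restrict x J" by (rule someI[of _ x]) (use that in simp)
    then show ?thesis using that by (intro det) (auto simp: restrict_def fun_eq_iff split: if_splits)
  qed
  then have "\<exists>\<phi>. \<forall>x\<in>C. x i = \<phi> (restrict x J)"
    by (intro exI[of _ "\<lambda>z. (SOME y. y \<in> C \<and> restrict y J = z) i"] ballI)
  with J show "\<exists>J\<subseteq>I. i \<notin> J \<and> card J \<le> r \<and> (\<exists>\<phi>. \<forall>x\<in>C. x i = \<phi> (restrict x J))" by blast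
qed

text \<open>The recovering set of \<open>x\<close> is its block without \<open>x\<close>. It has
  \<open>card B - 1\<close> points, more than the degree of \<open>p\<close>, so the values there
  determine \<open>p\<close> and with it the value at \<open>x\<close>.\<close>

lemma eval_locality:
  fixes F :: "'a::field poly set"
  assumes "finite A"
    and loc: "\<And>x. x \<in> A \<Longrightarrow> \<exists>B\<subseteq>A. x \<in> B \<and> card B \<le> r + 1 \<and>
      (\<forall>f\<in>F. \<exists>p. degree p < card B - 1 \<and> (\<forall>y\<in>B. poly f y = poly p y))"
  shows "has_locality A (eval_word A ` F) r"
proof (rule has_localityI)
  fix x assume "x \<in> A"
  then obtain B where B: "B \<subseteq> A" "x \<in> B" "card B \<le> r + 1"
    and p: "\<And>f. f \<in> F \<Longrightarrow> \<exists>p. degree p < card B - 1 \<and> (\<forall>y\<in>B. poly f y = poly p y)"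
    using loc[OF \<open>x \<in> A\<close>] by blast
  have card: "card (B - {x}) = card B - 1" using B \<open>finite A\<close> by (simp add: finite_subset)
  have "poly f x = poly f' x"
    if "f \<in> F" "f' \<in> F" and eq: "\<And>y. y \<in> B - {x} \<Longrightarrow> poly f y = poly f' y" for f f'
  proof -
    obtain p where "degree p < card B - 1" "\<And>y. y \<in> B \<Longrightarrow> poly f y = poly p y"
      using p[OF \<open>f \<in> F\<close>] by blast
    moreover obtain p' where "degree p' < card B - 1" "\<And>y. y \<in> B \<Longrightarrow> poly f' y = poly p' y"
      using p[OF \<open>f' \<in> F\<close>] by blast
    moreover from calculation have "p = p'"
      using eq card by (intro poly_eq_if_agree[of _ "B - {x}"]) auto
    ultimately show ?thesis using B by simp
  qed
  moreover have "eval_word A f y = poly f y" if "y \<in> B" for f y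
    using that B by (auto simp: eval_word_def)
  ultimately have
    "\<forall>f\<in>F. \<forall>f'\<in>F. (\<forall>l\<in>B - {x}. eval_word A f l = eval_word A f' l) \<longrightarrow>
      eval_word A f x = eval_word A f' x"
    using B by (metis DiffD1)
  with B card show "\<exists>J. J \<subseteq> A \<and> x \<notin> J \<and> card J \<le> r \<and>
      (\<forall>u\<in>eval_word A ` F. \<forall>v\<in>eval_word A ` F. (\<forall>l\<in>J. u l = v l) \<longrightarrow> u x = v x)"
    by (intro exI[of _ "B - {x}"] conjI) (blast | simp)+
qed

text \<open>Coordinates where the two words agree are roots of \<open>p - q\<close>.\<close>

lemma hamming_dist_eval_word:
  fixes p q :: "'a::field poly"
  assumes "finite A" and "p \<noteq> q"
  shows "card A \<le> hamming_dist A (eval_word A p) (eval_word A q) + degree (p - q)"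
proof -
  let ?D = "{x \<in> A. poly p x \<noteq> poly q x}" and ?E = "{x \<in> A. poly p x = poly q x}"
  have "card A = card (?D \<union> ?E)" by (rule arg_cong[of _ _ card]) auto
  also have "\<dots> \<le> card ?D + card ?E" by (rule card_Un_le)
  also have "?D = {x \<in> A. eval_word A p x \<noteq> eval_word A q x}" by (auto simp: eval_word_def)
  finally show ?thesis
    using card_agree_le_degree[OF \<open>p \<noteq> q\<close>, of A] by (simp add: hamming_dist_def)
qed

section \<open>The encoding polynomial as a single sum over index pairs\<close>

text \<open>This is the cofactor of the powers of \<open>g\<close> in the encoding. If
  \<open>h\<close> has degree \<open>s\<close>, the degree is \<open>i\<close> in both branches,
  while the second branch vanishes at the roots of \<open>h\<close>.\<close>

definition factor_poly :: "nat \<Rightarrow> 'a::field poly \<Rightarrow> nat \<Rightarrow> 'a poly" where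
  "factor_poly s h i = (if i < s then monom 1 i else monom 1 (i - s) * h)"

definition code_pairs :: "nat \<Rightarrow> nat \<Rightarrow> nat \<Rightarrow> (nat \<times> nat) set" where
  "code_pairs r s t = {..<r} \<times> {..<t} - {(s - 1, 0)}"

lemma finite_code_pairs [simp]: "finite (code_pairs r s t)"
  by (simp add: code_pairs_def)

lemma enc_poly_eq_sum:
  assumes "1 \<le> s" and "s \<le> r"
  shows "enc_poly r s t g h a =
    (\<Sum>(i, j)\<in>code_pairs r s t. smult (msg_entry s t a i j) (g ^ j * factor_poly s h i))"
    (is "_ = sum ?f _")
proof -
  have split: "code_pairs r s t =
      ({0..<s - 1} \<times> {0..<t} \<union> {s - 1} \<times> {1..<t}) \<union> {s..<r} \<times> {0..<t}"
    using assms by (auto simp: code_pairs_def)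
  have "sum ?f (code_pairs r s t) = sum ?f ({0..<s - 1} \<times> {0..<t}) + sum ?f ({s - 1} \<times> {1..<t})
      + sum ?f ({s..<r} \<times> {0..<t})"
    unfolding split using assms by (subst sum.union_disjoint; (subst sum.union_disjoint)?) auto
  also have "\<dots> = enc_poly r s t g h a"
    using assms unfolding enc_poly_def sum.cartesian_product[symmetric]
    by (auto simp: factor_poly_def mult.assoc intro!: arg_cong2[of _ _ _ _ "(+)"] sum.cong)
  finally show ?thesis by simp
qed

text \<open>Transfers vanishing of all coefficients to vanishing of the whole message. Before
  position \<open>(s - 1) * t\<close> the row and column are quotient and remainder of
  \<open>l\<close> by \<open>t\<close>; from there on the gap at \<open>(s - 1, 0)\<close> shifts
  the numbering, and \<open>l + 1\<close> is divided instead.\<close>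

lemma msg_entry_surj:
  assumes "1 \<le> s" and "s \<le> r" and "k + 1 = r * t" and "l < k"
  obtains i j where "(i, j) \<in> code_pairs r s t" and "\<And>a. msg_entry s t a i j = a l"
proof (cases "l < (s - 1) * t")
  case True
  have "t > 0" using True by (cases t) auto
  have "l div t < s - 1" using True \<open>t > 0\<close> by (simp add: less_mult_imp_div_less)
  with \<open>t > 0\<close> assms that[of "l div t" "l mod t"] show ?thesis
    by (auto simp: code_pairs_def msg_entry_def)
next
  case False
  have "t > 0" using assms by (cases t) auto
  let ?i = "(l + 1) div t" and ?j = "(l + 1) mod t"
  have eq: "?i * t + ?j = l + 1" by (rule div_mult_mod_eq)
  have "?i \<ge> s - 1" using False \<open>t > 0\<close> by (simp add: less_eq_div_iff_mult_less_eq)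
  moreover have "?i < r" using assms by (simp add: less_mult_imp_div_less)
  \<comment> \<open>The gap itself would need \<open>l + 1 = (s - 1) * t\<close>, which lies below
    the present range of \<open>l\<close>.\<close>
  moreover have "(?i, ?j) \<noteq> (s - 1, 0)"
  proof
    assume "(?i, ?j) = (s - 1, 0)"
    then have "(s - 1) * t = l + 1" using eq by (metis Pair_inject add_0_right)
    with False show False by simp
  qed
  ultimately show ?thesis using \<open>t > 0\<close> eq that[of ?i ?j]
    by (auto simp: code_pairs_def msg_entry_def)
qed

lemma degree_annihilator_poly:
  fixes B :: "'a::field set"
  assumes "finite B"
  shows "degree (annihilator_poly B) = card B" and "annihilator_poly B \<noteq> 0"
  using assms unfolding annihilator_poly_def
  by (auto simp: degree_prod_sum_eq)

lemma factor_poly_degree: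
  assumes "degree h = s" and "h \<noteq> 0"
  shows "degree (factor_poly s h i) = i" and "factor_poly s h i \<noteq> 0"
  using assms by (auto simp: factor_poly_def degree_mult_eq degree_monom_eq)

section \<open>Degree, injectivity and restriction to blocks of the encoding\<close>

context
  fixes r s t :: nat and g h :: "'a::field poly"
  assumes s: "2 \<le> s" "s \<le> r" and t: "1 \<le> t"
    and g: "degree g = r + 1" and h: "degree h = s" "h \<noteq> 0"
begin

lemma product_degree:
  "degree (g ^ j * factor_poly s h i) = j * (r + 1) + i" "g ^ j * factor_poly s h i \<noteq> 0"
proof -
  have "g \<noteq> 0" using g by auto
  then show "degree (g ^ j * factor_poly s h i) = j * (r + 1) + i" "g ^ j * factor_poly s h i \<noteq> 0"
    using factor_poly_degree[OF h, of i] g by (auto simp: degree_mult_eq degree_power_eq)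
qed

lemma degree_enc_poly: "degree (enc_poly r s t g h a) \<le> (r + 1) * t - 2"
proof -
  \<comment> \<open>The extreme case is \<open>i = r - 1\<close>, \<open>j = t - 1\<close>.\<close>
  have "j * (r + 1) + i \<le> (r + 1) * t - 2" if "(i, j) \<in> code_pairs r s t" for i j
  proof -
    have "i < r" "j + 1 \<le> t" using that by (auto simp: code_pairs_def)
    from mult_le_mono1[OF this(2), of "r + 1"] this(1) show ?thesis by (simp add: algebra_simps)
  qed
  then show ?thesis
    using s by (subst enc_poly_eq_sum)
      (auto intro!: degree_sum_le order.trans[OF degree_smult_le] simp: product_degree)
qed

lemma enc_poly_diff:
  "enc_poly r s t g h a - enc_poly r s t g h b = enc_poly r s t g h (\<lambda>l. a l - b l)"
  using s by (simp add: enc_poly_eq_sum sum_subtractf[symmetric] case_prod_beta msg_entry_def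
      smult_diff_left)

lemma enc_poly_eq_0:
  assumes "k + 1 = r * t" and "enc_poly r s t g h c = 0" and "l < k"
  shows "c l = 0"
proof -
  obtain i j where ij: "(i, j) \<in> code_pairs r s t" and l: "\<And>a :: nat \<Rightarrow> 'a. msg_entry s t a i j = a l"
    using msg_entry_surj[of s r k t l] assms s by auto
  let ?q = "\<lambda>(i, j). g ^ j * factor_poly s h i"
  \<comment> \<open>Since \<open>i < r\<close>, division by \<open>r + 1\<close> recovers the pair
    from the degree, so the degrees are pairwise distinct.\<close>
  have "(j * (r + 1) + i) mod (r + 1) = i" "(j * (r + 1) + i) div (r + 1) = j"
    if "(i, j) \<in> code_pairs r s t" for i j
    using that by (auto simp: code_pairs_def div_mult_self3[of "r + 1"] simp del: add_Suc_right)
  then have inj: "inj_on (\<lambda>p. degree (?q p)) (code_pairs r s t)"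
    by (auto simp: inj_on_def product_degree) metis+
  have nz: "?q p \<noteq> 0" for p
    using product_degree(2)[of "snd p" "fst p"] by (simp only: case_prod_beta not_False_eq_True)
  have sum: "(\<Sum>p\<in>code_pairs r s t. smult (case_prod (msg_entry s t c) p) (?q p)) = 0"
    using assms(2) s by (simp add: enc_poly_eq_sum case_prod_beta)
  from distinct_degrees_independent[OF finite_code_pairs inj nz sum ij] l[of c] show ?thesis by simp
qed

lemma enc_poly_inj:
  assumes "k + 1 = r * t"
  shows "inj_on (enc_poly r s t g h) ({..<k} \<rightarrow>\<^sub>E UNIV)"
proof (rule inj_onI)
  fix a b assume ab: "a \<in> {..<k} \<rightarrow>\<^sub>E UNIV" "b \<in> {..<k} \<rightarrow>\<^sub>E UNIV"
    and "enc_poly r s t g h a = enc_poly r s t g h b"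
  then have "enc_poly r s t g h (\<lambda>l. a l - b l) = 0" by (simp add: enc_poly_diff[symmetric])
  from enc_poly_eq_0[OF assms this] have "a l = b l" if "l < k" for l using that by simp
  then show "a = b" by (intro PiE_ext[OF ab]) simp
qed

lemma enc_poly_on_long_block:
  assumes "\<And>x. x \<in> B \<Longrightarrow> poly g x = \<gamma>"
  shows "\<exists>p. degree p < r \<and> (\<forall>x\<in>B. poly (enc_poly r s t g h a) x = poly p x)"
proof (intro exI conjI ballI)
  \<comment> \<open>With \<open>g\<close> replaced by its constant value, only the cofactors, of
    degree \<open>i < r\<close>, contribute to the degree.\<close>
  let ?p = "\<Sum>(i, j)\<in>code_pairs r s t. smult (msg_entry s t a i j * \<gamma> ^ j) (factor_poly s h i)"
  have "degree ?p \<le> r - 1"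
    by (intro degree_sum_le) (auto intro!: order.trans[OF degree_smult_le]
        simp: factor_poly_degree[OF h] code_pairs_def)
  then show "degree ?p < r" using s by simp
  fix x assume "x \<in> B"
  then show "poly (enc_poly r s t g h a) x = poly ?p x"
    using s assms by (simp add: enc_poly_eq_sum poly_sum case_prod_beta mult.assoc)
qed

lemma enc_poly_on_short_block:
  assumes "\<And>x. x \<in> B \<Longrightarrow> poly g x = 0" and "\<And>x. x \<in> B \<Longrightarrow> poly h x = 0"
  shows "\<exists>p. degree p < s - 1 \<and> (\<forall>x\<in>B. poly (enc_poly r s t g h a) x = poly p x)"
proof (intro exI conjI ballI)
  let ?p = "\<Sum>i<s - 1. smult (msg_entry s t a i 0) (monom 1 i)"
  have "degree ?p \<le> s - 2"
    by (intro degree_sum_le) (auto intro!: order.trans[OF degree_smult_le] simp: degree_monom_eq)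
  then show "degree ?p < s - 1" using s by simp
  fix x assume x: "x \<in> B"
  let ?f = "\<lambda>(i, j). msg_entry s t a i j * (0 ^ j * poly (factor_poly s h i) x)"
  have "poly (enc_poly r s t g h a) x = sum ?f (code_pairs r s t)"
    using s assms(1)[OF x] by (simp add: enc_poly_eq_sum poly_sum case_prod_beta)
  \<comment> \<open>The factor \<open>0 ^ j\<close> leaves only \<open>j = 0\<close>, and the zeros
    of \<open>h\<close> remove all \<open>i\<close> from \<open>s\<close> on. The row
    \<open>i = s - 1\<close> has no entry with \<open>j = 0\<close>.\<close>
  also have "\<dots> = sum ?f ((\<lambda>i. (i, 0)) ` {..<s - 1})"
    using s t assms(2)[OF x]
    by (intro sum.mono_neutral_right) (auto simp: code_pairs_def factor_poly_def power_0_left split: if_splits)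
  also have "\<dots> = poly ?p x"
    by (subst sum.reindex)
      (auto simp: inj_on_def poly_sum poly_monom factor_poly_def intro!: sum.cong)
  finally show "poly (enc_poly r s t g h a) x = poly ?p x" .
qed

end

section \<open>Size, locality and distance of the code\<close>

text \<open>Applied with \<open>j = 1\<close>, this lets the span hypothesis show that
  \<open>g\<close> is constant on every block.\<close>

lemma power_mem_span_powers:
  fixes g :: "'a::field poly"
  assumes "j \<in> N"
  shows "g ^ j \<in> module.span smult ((\<lambda>j. g ^ j) ` N)"
proof -
  interpret module "smult :: 'a \<Rightarrow> 'a poly \<Rightarrow> 'a poly"
    by unfold_locales (auto simp: smult_add_right smult_add_left)
  show ?thesis using assms by (intro span_base imageI)
qed

theorem theorem5p2:
  fixes n k r s m :: nat
    and A :: "'a::{field,finite} set"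
    and P :: "nat \<Rightarrow> 'a set"
    and g :: "'a poly"
  assumes "n \<ge> 1" and "k \<ge> 1" and "r \<ge> 1"
    and "s = n mod (r + 1)" and "s \<notin> {0, 1}"
    and "r dvd k + 1"
    and "real k \<le> real r * real n / real (r + 1)"
    and "card A = n"
    and "m = nat \<lceil>real n / real (r + 1)\<rceil>"
    and "partition_on A (P ` {1..m})" and "inj_on P {1..m}"
    and "\<forall>i\<in>{1..m - 1}. card (P i) = r + 1"
    and "card (P m) = s"
    and "degree g = r + 1"
    and "module.span smult ((\<lambda>j. g ^ j) ` {0..m - 1}) = block_const_polys A (P ` {1..m})"
    and "\<forall>\<alpha>\<in>P m. poly g \<alpha> = 0"
  shows "is_LRC_code A (lrc_code A k r s g (annihilator_poly (P m))) n k r \<and>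
    int (min_dist A (lrc_code A k r s g (annihilator_poly (P m))))
      \<ge> int n - int k - \<lceil>real k / real r\<rceil> + 1"
proof -
  define t where "t = (k + 1) div r"
  define h where "h = annihilator_poly (P m)"
  define F where "F = enc_poly r s t g h ` ({..<k} \<rightarrow>\<^sub>E UNIV)"
  define C where "C = lrc_code A k r s g h"
  have s: "2 \<le> s" "s \<le> r"
    using \<open>s \<notin> {0, 1}\<close> \<open>s = n mod (r + 1)\<close> mod_less_divisor[of "r + 1" n] by auto
  have kt: "k + 1 = r * t" using \<open>r dvd k + 1\<close> by (simp add: t_def)
  then have t: "1 \<le> t" by (cases t) auto
  have h: "degree h = s" "h \<noteq> 0"
    using degree_annihilator_poly[of "P m"] \<open>card (P m) = s\<close> by (auto simp: h_def)
  note ctx = s t \<open>degree g = r + 1\<close> h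
  have C_eq: "C = eval_word A ` F"
    by (auto simp: C_def lrc_code_def F_def t_def)

  have n_ge: "(r + 1) * t \<le> n + 1"
  proof -
    have "real (k * (r + 1)) \<le> real (r * n)"
      using \<open>real k \<le> real r * real n / real (r + 1)\<close> by (simp add: field_simps)
    then have "k * (r + 1) \<le> r * n" by (simp only: of_nat_le_iff)
    then have "(k + 1) * (r + 1) \<le> r * n + (r + 1)" by (simp add: algebra_simps)
    \<comment> \<open>From \<open>2 \<le> s \<le> r\<close> follows \<open>r + 1 < 2 * r\<close>.
      The strictness, kept when \<open>r\<close> is cancelled, gives the bound
      \<open>n + 1\<close>.\<close>
    also have "\<dots> < r * (n + 2)" using s by simp
    finally have "r * ((r + 1) * t) < r * (n + 2)" unfolding kt by (simp only: mult_ac)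
    then have "(r + 1) * t < n + 2" by (simp only: mult_less_cancel1)
    then show ?thesis by simp
  qed
  \<comment> \<open>Makes the subtraction in the degree bound \<open>(r + 1) * t - 2\<close> exact
    on natural numbers.\<close>
  have "2 \<le> (r + 1) * t" using s t by (metis mult_le_mono mult.right_neutral le_trans trans_le_add1)

  have deg: "degree (f - f') \<le> (r + 1) * t - 2" if "f \<in> F" "f' \<in> F" for f f'
    using that degree_enc_poly[OF ctx] by (auto simp: F_def enc_poly_diff[OF ctx])
  have dist: "n + 2 \<le> hamming_dist A (eval_word A f) (eval_word A f') + (r + 1) * t"
    if "f \<in> F" "f' \<in> F" "f \<noteq> f'" for f f'
    using hamming_dist_eval_word[of A f f'] deg[of f f'] that \<open>card A = n\<close> \<open>2 \<le> (r + 1) * t\<close>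
    by simp
  have inj: "inj_on (eval_word A) F"
  proof (rule inj_onI, rule ccontr)
    fix f f' assume "f \<in> F" "f' \<in> F" "eval_word A f = eval_word A f'" "f \<noteq> f'"
    \<comment> \<open>Equal words have distance 0, which would force
      \<open>n + 2 \<le> (r + 1) * t \<le> n + 1\<close>.\<close>
    with dist[of f f'] n_ge show False by (simp add: hamming_dist_def)
  qed
  have card_C: "card C = CARD('a) ^ k"
    unfolding C_eq card_image[OF inj] unfolding F_def card_image[OF enc_poly_inj[OF ctx kt]]
    by (simp add: card_PiE)

  have "has_locality A C r" unfolding C_eq
  proof (rule eval_locality)
    fix x assume "x \<in> A"
    have A: "A = (\<Union>l\<in>{1..m}. P l)"
      using \<open>partition_on A (P ` {1..m})\<close> by (simp add: partition_on_def)
    with \<open>x \<in> A\<close> obtain l where l: "l \<in> {1..m}" "x \<in> P l" by blast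
    from A l have sub: "P l \<subseteq> A" by blast
    have "card (P l) \<le> r + 1 \<and>
      (\<forall>f\<in>F. \<exists>p. degree p < card (P l) - 1 \<and> (\<forall>y\<in>P l. poly f y = poly p y))"
    proof (cases "l = m")
      case True
      have "poly h y = 0" if "y \<in> P m" for y
        using that by (auto simp: h_def annihilator_poly_def poly_prod)
      then show ?thesis
        using True \<open>card (P m) = s\<close> s \<open>\<forall>\<alpha>\<in>P m. poly g \<alpha> = 0\<close>
          enc_poly_on_short_block[OF ctx, of "P m"] by (auto simp: F_def)
    next
      case False
      \<comment> \<open>The presence of a long block means \<open>m \<ge> 2\<close>, so the exponent
        1 is among \<open>0..m - 1\<close>.\<close>
      with l have "l \<in> {1..m - 1}" by auto
      then have "g ^ 1 \<in> block_const_polys A (P ` {1..m})"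
        using power_mem_span_powers[of 1 "{0..m - 1}" g] assms(15) by auto
      with l have "poly g y = poly g x" if "y \<in> P l" for y
        using that unfolding block_const_polys_def power_one_right by blast
      note enc_poly_on_long_block[OF ctx, of "P l", OF this]
      moreover have "card (P l) = r + 1" using \<open>l \<in> {1..m - 1}\<close> assms(12) by blast
      ultimately show ?thesis by (simp add: F_def)
    qed
    with l sub show "\<exists>B\<subseteq>A. x \<in> B \<and> card B \<le> r + 1 \<and>
      (\<forall>f\<in>F. \<exists>p. degree p < card B - 1 \<and> (\<forall>y\<in>B. poly f y = poly p y))" by blast
  qed simp
  moreover have "C \<subseteq> (A \<rightarrow>\<^sub>E UNIV)" by (auto simp: C_eq eval_word_def)
  ultimately have lrc: "is_LRC_code A C n k r"
    using card_C \<open>card A = n\<close> by (simp add: is_LRC_code_def)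

  have "\<lceil>real k / real r\<rceil> = int t"
  proof (rule ceiling_unique)
    \<comment> \<open>Hence \<open>k / r = t - 1 / r\<close>, which exceeds \<open>t - 1\<close>
      because \<open>r \<ge> 2\<close>.\<close>
    have "real k = real r * real t - 1"
      using kt by (metis add_diff_cancel_right' of_nat_1 of_nat_add of_nat_mult)
    then show "real_of_int (int t) - 1 < real k / real r" "real k / real r \<le> real_of_int (int t)"
      using s by (auto simp: field_simps)
  qed
  moreover
  let ?D = "{hamming_dist A x y | x y. x \<in> C \<and> y \<in> C \<and> x \<noteq> y}"
  have "n + 2 \<le> Min ?D + (r + 1) * t"
  proof -
    have "?D \<subseteq> {..card A}" by (auto simp: hamming_dist_def intro!: card_mono)
    then have fin: "finite ?D" by (rule finite_subset) simp
    \<comment> \<open>A field has at least two elements and \<open>k \<ge> 1\<close>, so there are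
      two distinct codewords and the minimum is attained.\<close>
    have "CARD('a) > 1"
      using card_mono[of "UNIV :: 'a set" "{0, 1}"] by simp
    then have "\<not> card C \<le> Suc 0"
      using one_less_power[of "CARD('a)" k] \<open>k \<ge> 1\<close> by (simp add: card_C)
    then have "?D \<noteq> {}"
      using card_le_Suc0_iff_eq[of C] by (auto simp: C_eq F_def finite_PiE)
    from Min_in[OF fin this] obtain f f' where "f \<in> F" "f' \<in> F" "f \<noteq> f'"
      and "Min ?D = hamming_dist A (eval_word A f) (eval_word A f')"
      by (auto simp: C_eq)
    with dist show ?thesis by simp
  qed
  \<comment> \<open>Turns the bound \<open>n + 2 - (r + 1) * t\<close> into
    \<open>n - k - t + 1\<close>, where \<open>t\<close> is the ceiling of
    \<open>k / r\<close>.\<close>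
  moreover have "(r + 1) * t = k + 1 + t" using kt by simp
  ultimately have "int (min_dist A C) \<ge> int n - int k - \<lceil>real k / real r\<rceil> + 1"
    by (simp add: min_dist_def)
  with lrc show ?thesis by (simp add: C_def h_def)
qed

end
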